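(* Let $\mathrm{g}\ge1$, $A(X)=X^{\mathrm{g}+1}+\sum_{j=0}^{\mathrm{g}-1}k^{(j)}X^j$, $R$ a polynomial of degree at most $\mathrm{g}$, $F=A^2+4R$, and let $(P_n,Q_n,u_n,d_n,v_n)_{n\in\mathbb{Z}}$ be the doubly infinite sequence associated with $Y_0=(Y+P_0)/Q_0$ as in the context (all $u_n,d_n$ nonzero). Let $G^\dagger=Y_0=\sum_{j\ge1}s^\dagger_{j-1}X^{-j}$ be the expansion of $Y_0$ at $\infty_2$, and let $\Delta^\dagger_n=\det(s^\dagger_{i+j-2})_{i,j=1}^n$ and $\Delta_n^{\dagger*}$ the corresponding shifted Hankel determinant ($\Delta_0^\dagger=1$, $\Delta_0^{\dagger*}=0$). Then $$d_{1-n}=\frac{\Delta^\dagger_n\Delta^\dagger_{n-2}}{(\Delta^\dagger_{n-1})^2}\ (n\ge2),\qquad v_{-n}=\frac{\Delta^{\dagger*}_{n-1}}{\Delta^\dagger_{n-1}}-\frac{\Delta^{\dagger*}_n}{\Delta^\dagger_n}\ (n\ge1),$$ where $s_0^\dagger=-u_{-1}/2$ and, for $j\ge1$ (with $s^\dagger_i=0$ for $i<0$), $$s^\dagger_j=-\sum_{i=2}^{\mathrm{g}+1}\big(k^{(\mathrm{g}+1-i)}+\pi_0^{(\mathrm{g}+1-i)}\big)s^\dagger_{j-i}+\frac{d_0}{s^\dagger_0}\Big(\sum_{i=0}^{j-2}s^\dagger_is^\dagger_{j-2-i}+\sum_{\ell=3}^{\mathrm{g}+2}\sum_{i=0}^{j-\ell}\rho_0^{(\mathrm{g}+2-\ell)}s^\dagger_is^\dagger_{j-\ell-i}\Big)+\bar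 s^\dagger_j,$$ with $\bar s^\dagger_j=s^\dagger_0\rho_{-1}^{(\mathrm{g}-j)}$ for $1\le j\le\mathrm{g}$ and $\bar s^\dagger_j=0$ for $j\ge\mathrm{g}+1$.
   Context: Setting: $Y^2=F(X)$ with points at infinity $\infty_1,\infty_2$ where $Y\sim X^{\mathrm{g}+1}$, resp. $Y\sim-X^{\mathrm{g}+1}$, as $X\to\infty$; expansions at these points are Laurent series in $X^{-1}$. Take $P_0(X)=A(X)+2d_0X^{\mathrm{g}-1}+\cdots$ of degree $\mathrm{g}+1$ and $Q_0$ of degree $\mathrm{g}$ with leading coefficient $u_0\ne0$, $Q_0\mid F-P_0^2$, and $Y_0=(Y+P_0)/Q_0$. For $n\ge0$, the continued fraction expansion $Y_n=a_n+1/Y_{n+1}$, $a_n=\lfloor Y_n\rfloor$ of $Y_0$ at $\infty_1$ gives $a_n=2(X+v_n)/u_n$, $Y_n=(Y+P_n)/Q_n$, with $P_n=A+\sum_{j=0}^{\mathrm{g}-1}\pi_n^{(j)}X^j$, $Q_n=u_n(X^{\mathrm{g}}+\sum_{j=0}^{\mathrm{g}-1}\rho_n^{(j)}X^j)$, $\pi_n^{(\mathrm{g}-1)}=2d_n$, $\rho_n^{(\mathrm{g}-1)}=-v_n$. These quantities satisfy, for all $n$, $F=P_n^2+Q_nQ_{n-1}$, $4d_n+u_nu_{n-1}=0$, $(X+v_n)(P_{n+1}-P_n)=\tfrac12u_n(Q_{n-1}-Q_{n+1})$ and $(X+v_n)Q_n=\tfrac12u_n(P_{n+1}+P_n)$;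 these relations determine $(P_n,Q_{n-1})$ rationally from $(P_{n+1},Q_n)$, and the sequences are extended to all $n\in\mathbb{Z}$ in this way, assuming no $u_n,d_n$ vanish. The shifted Hankel determinant $\Delta_n^{\dagger*}$ is the $n\times n$ determinant with $(i,j)$ entry $s^\dagger_{i+j-2}$ for $j\le n-1$ and $s^\dagger_{i+n-1}$ for $j=n$. *)

theory Defs
  imports
    "HOL-Computational_Algebra.Formal_Laurent_Series"
    "Jordan_Normal_Form.Determinant"
begin

text \<open>
  Expansions at a point at infinity are elements of \<^typ>\<open>'a fls\<close> whose indeterminate stands for
  the local parameter \<open>X\<^sup>-\<^sup>1\<close>: \<open>fls_nth f m\<close> is the coefficient of \<open>X\<close> to the power \<open>- m\<close>, and
  \<open>X\<close> itself is \<open>fls_X_inv\<close>.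
\<close>

definition poly_at_inf :: "'a::field poly \<Rightarrow> 'a fls" where
  "poly_at_inf p = poly (map_poly fls_const p) fls_X_inv"

text \<open>
  The polynomial part in \<open>X\<close>. The principal part \<open>fls_prpart\<close> leaves out the constant term.
\<close>

definition floor_at_inf :: "'a::field fls \<Rightarrow> 'a poly" where
  "floor_at_inf f = fls_prpart f + [:fls_nth f 0:]"

text \<open>
  \<open>Y\<close> is the expansion of the square root of \<open>F\<close> (of degree \<open>2 * g + 2\<close>) with
  leading term \<open>c * X ^ (g + 1)\<close>; \<open>c = 1\<close> at the first and \<open>c = - 1\<close> at the second point at infinity.
\<close>

definition sqrt_expansion :: "nat \<Rightarrow> 'a::field poly \<Rightarrow> 'a \<Rightarrow> 'a fls \<Rightarrow> bool" where
  "sqrt_expansion g F c Y \<longleftrightarrow>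
     Y ^ 2 = poly_at_inf F \<and>
     fls_subdegree Y = - int (g + 1) \<and> fls_nth Y (- int (g + 1)) = c"

text \<open>
  Complete quotients of the continued fraction of \<open>y\<close>. If some remainder vanishes, so do all later
  quotients (\<open>inverse 0 = 0\<close>).
\<close>

primrec complete_quotient :: "'a::field fls \<Rightarrow> nat \<Rightarrow> 'a fls" where
  "complete_quotient y 0 = y"
| "complete_quotient y (Suc n) =
     inverse (complete_quotient y n - poly_at_inf (floor_at_inf (complete_quotient y n)))"

text \<open>
  The doubly infinite sequence attached to \<open>(Y + P 0) / Q 0\<close>, where \<open>Y\<close> is the expansion at the
  first point at infinity. For nonnegative indices it is given by the continued fraction, from which
  the relations in the last four clauses follow; for negative indices these relations
  are the definition of the extension.
\<close>

definition cf_sequence ::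
  "nat \<Rightarrow> 'a::field poly \<Rightarrow> 'a poly \<Rightarrow> 'a fls \<Rightarrow> (int \<Rightarrow> 'a poly) \<Rightarrow> (int \<Rightarrow> 'a poly) \<Rightarrow>
   (int \<Rightarrow> 'a) \<Rightarrow> (int \<Rightarrow> 'a) \<Rightarrow> (int \<Rightarrow> 'a) \<Rightarrow> (int \<Rightarrow> nat \<Rightarrow> 'a) \<Rightarrow> (int \<Rightarrow> nat \<Rightarrow> 'a) \<Rightarrow> bool" where
  "cf_sequence g A F Y P Q u d v \<pi> \<rho> \<longleftrightarrow>
     Q 0 dvd F - P 0 ^ 2 \<and>
     (\<forall>n. P n = A + (\<Sum>j<g. monom (\<pi> n j) j)) \<and>
     (\<forall>n. Q n = Polynomial.smult (u n) (monom 1 g + (\<Sum>j<g. monom (\<rho> n j) j))) \<and>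
     (\<forall>n. \<pi> n (g - 1) = 2 * d n) \<and>
     (\<forall>n. \<rho> n (g - 1) = - v n) \<and>
     (\<forall>n. u n \<noteq> 0 \<and> d n \<noteq> 0) \<and>
     (\<forall>n::nat.
        let Yn = complete_quotient ((Y + poly_at_inf (P 0)) / poly_at_inf (Q 0)) n in
          Yn = (Y + poly_at_inf (P (int n))) / poly_at_inf (Q (int n)) \<and>
          floor_at_inf Yn = Polynomial.smult (2 / u (int n)) [:v (int n), 1:]) \<and>
     (\<forall>n. F = P n ^ 2 + Q n * Q (n - 1)) \<and>
     (\<forall>n. 4 * d n + u n * u (n - 1) = 0) \<and>
     (\<forall>n. [:v n, 1:] * (P (n + 1) - P n) = Polynomial.smult (u n / 2) (Q (n - 1) - Q (n + 1))) \<and>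
     (\<forall>n. [:v n, 1:] * Q n = Polynomial.smult (u n / 2) (P (n + 1) + P n))"

text \<open>
  Hankel determinants of \<open>s\<close>; row and column indices of \<^const>\<open>mat\<close> start at \<open>0\<close>. In the shifted
  one the indices in the last column are increased by one.
\<close>

definition hankel :: "(int \<Rightarrow> 'a::field) \<Rightarrow> nat \<Rightarrow> 'a" where
  "hankel s n = det (mat n n (\<lambda>(i, j). s (int i + int j)))"

definition shifted_hankel :: "(int \<Rightarrow> 'a::field) \<Rightarrow> nat \<Rightarrow> 'a" where
  "shifted_hankel s n =
     (if n = 0 then 0
      else det (mat n n (\<lambda>(i, j). if j = n - 1 then s (int i + int n) else s (int i + int j))))"

end

theory Submission
  imports Defs
begin

text \<open>
  At negative indices the relations say \<open>Z\<^sub>n = a\<^sub>n\<^sub>-\<^sub>1 + 1 / Z\<^sub>n\<^sub>-\<^sub>1\<close> for \<open>Z\<^sub>n = (P\<^sub>n - Y) / Q\<^sub>n\<^sub>-\<^sub>1\<close>, where \<open>Y\<close> is the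
  expansion at the second point at infinity, and \<open>G = - 1 / Z\<^sub>0\<close>. After normalisation this is the
  J-fraction \<open>G = s\<^sub>0 / (X + v\<^sub>-\<^sub>1 - d\<^sub>-\<^sub>1 / (X + v\<^sub>-\<^sub>2 - d\<^sub>-\<^sub>2 / \<dots>))\<close>. If \<open>G (X - b - H) = c\<close>, the Hankel matrix of \<open>G\<close>
  of size \<open>n + 1\<close> factors through the block diagonal matrix of \<open>1\<close> and the Hankel matrix of \<open>H\<close> of
  size \<open>n\<close>, with triangular Toeplitz matrices of coefficients of \<open>G\<close> on both sides. Hence the
  quotients in the theorem for \<open>G\<close> at \<open>n + 1\<close> are those for \<open>H\<close> at \<open>n\<close>, and induction reduces them
  to the leading coefficients. The recurrence for \<open>s\<close> is the coefficient form of
  \<open>Q\<^sub>0 G\<^sup>2 = 2 P\<^sub>0 G + Q\<^sub>-\<^sub>1\<close>.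
\<close>

section \<open>Hankel determinants and J-fractions\<close>

lemma det_sum_upper:
  fixes f h :: "nat \<Rightarrow> nat \<Rightarrow> 'a::comm_ring_1"
  assumes "\<And>b j. j < b \<Longrightarrow> b < m \<Longrightarrow> h b j = 0"
  shows "det (mat m m (\<lambda>(i, j). \<Sum>b<m. f i b * h b j)) =
    det (mat m m (\<lambda>(i, j). f i j)) * (\<Prod>j<m. h j j)"
proof -
  let ?U = "mat m m (\<lambda>(i, j). h i j)"
  have "mat m m (\<lambda>(i, j). \<Sum>b<m. f i b * h b j) = mat m m (\<lambda>(i, j). f i j) * ?U"
    by (rule eq_matI) (auto simp: scalar_prod_def atLeast0LessThan)
  moreover have "det ?U = prod_list (diag_mat ?U)"
    by (rule det_upper_triangular) (auto intro!: upper_triangularI assms)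
  moreover have "prod_list (diag_mat ?U) = (\<Prod>j<m. h j j)"
    by (simp add: diag_mat_def prod.list_conv_set_nth atLeast0LessThan)
  ultimately show ?thesis
    by (simp add: det_mult[of _ m])
qed

lemma det_sum_lower:
  fixes f h :: "nat \<Rightarrow> nat \<Rightarrow> 'a::comm_ring_1"
  assumes "\<And>i a. i < a \<Longrightarrow> a < m \<Longrightarrow> h i a = 0"
  shows "det (mat m m (\<lambda>(i, j). \<Sum>a<m. h i a * f a j)) =
    (\<Prod>j<m. h j j) * det (mat m m (\<lambda>(i, j). f i j))"
proof -
  have tr: "det (mat m m (\<lambda>(i, j). k i j)) = det (mat m m (\<lambda>(i, j). k j i))"
    for k :: "nat \<Rightarrow> nat \<Rightarrow> 'a"
  proof -
    have "transpose_mat (mat m m (\<lambda>(i, j). k i j)) = mat m m (\<lambda>(i, j). k j i)"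
      by (rule eq_matI) auto
    then show ?thesis
      using det_transpose[of "mat m m (\<lambda>(i, j). k i j)" m] by simp
  qed
  show ?thesis
    using det_sum_upper[of m "\<lambda>b j. h j b" "\<lambda>i b. f b i"] assms
    by (subst (1 2) tr) (simp add: mult.commute)
qed

lemma det_first_column_unit:
  fixes f :: "nat \<Rightarrow> nat \<Rightarrow> 'a::comm_ring_1"
  assumes "f 0 0 = 1" and "\<And>i. f (Suc i) 0 = 0"
  shows "det (mat (Suc n) (Suc n) (\<lambda>(i, j). f i j)) = det (mat n n (\<lambda>(i, j). f (Suc i) (Suc j)))"
proof -
  let ?M = "mat (Suc n) (Suc n) (\<lambda>(i, j). f i j)"
  have "det ?M = (\<Sum>i<Suc n. ?M $$ (i, 0) * cofactor ?M i 0)"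
    by (rule laplace_expansion_column) auto
  also have "\<dots> = cofactor ?M 0 0"
    by (subst sum.lessThan_Suc_shift) (simp add: assms)
  also have "mat_delete ?M 0 0 = mat n n (\<lambda>(i, j). f (Suc i) (Suc j))"
    by (rule eq_matI) (auto simp: mat_delete_def)
  then have "cofactor ?M 0 0 = det (mat n n (\<lambda>(i, j). f (Suc i) (Suc j)))"
    by (simp add: cofactor_def)
  finally show ?thesis .
qed

lemma det_linear_last_column:
  fixes f :: "nat \<Rightarrow> nat \<Rightarrow> 'a::comm_ring_1"
  shows "det (mat (Suc n) (Suc n) (\<lambda>(i, j). if j = n then x * p i + y * q i else f i j)) =
    x * det (mat (Suc n) (Suc n) (\<lambda>(i, j). if j = n then p i else f i j)) +
    y * det (mat (Suc n) (Suc n) (\<lambda>(i, j). if j = n then q i else f i j))"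
proof -
  let ?M = "\<lambda>w. mat (Suc n) (Suc n) (\<lambda>(i, j). if j = n then w i else f i j)"
  \<comment> \<open>Cofactors along the last column do not involve its entries, so they can be
    computed with that column set to zero; this makes linearity in \<open>w\<close> visible.\<close>
  have "det (?M w) = (\<Sum>i<Suc n. w i * cofactor (?M (\<lambda>_. 0)) i n)" for w
  proof -
    have "det (?M w) = (\<Sum>i<Suc n. ?M w $$ (i, n) * cofactor (?M w) i n)"
      by (rule laplace_expansion_column) auto
    moreover have "mat_delete (?M w) i n = mat_delete (?M (\<lambda>_. 0)) i n" for i
      by (rule eq_matI) (auto simp: mat_delete_def)
    ultimately show ?thesis
      by (simp add: cofactor_def)
  qed
  then show ?thesis
    by (simp add: sum.distrib sum_distrib_left algebra_simps)
qed

section \<open>One J-fraction step applied to Hankel determinants\<close>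

definition hankel_nat :: "(nat \<Rightarrow> 'a::field) \<Rightarrow> nat \<Rightarrow> 'a" where
  "hankel_nat s n = det (mat n n (\<lambda>(i, j). s (i + j)))"

definition shifted_hankel_nat :: "(nat \<Rightarrow> 'a::field) \<Rightarrow> nat \<Rightarrow> 'a" where
  "shifted_hankel_nat s n = (if n = 0 then 0
     else det (mat n n (\<lambda>(i, j). if j = n - 1 then s (i + n) else s (i + j))))"

text \<open>
  The coefficient form of \<open>G * (X - b - H) = s 0\<close>, where \<open>s\<close> and \<open>t\<close> are the coefficients of \<open>G\<close>
  and \<open>H\<close> at \<open>X\<^sup>-\<^sup>1\<close>, \<open>X\<^sup>-\<^sup>2\<close>, and so on.
\<close>

definition jfrac_step :: "(nat \<Rightarrow> 'a::field) \<Rightarrow> 'a \<Rightarrow> (nat \<Rightarrow> 'a) \<Rightarrow> bool" where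
  "jfrac_step s b t \<longleftrightarrow> (\<forall>j. s (Suc j) = b * s j + (\<Sum>i<j. s (j - 1 - i) * t i))"

text \<open>Taking the divided difference of \<open>1 / G\<close> in two variables gives \<open>s 0
  * (G(Z) - G(X)) / (X - Z) = G(X) * G(Z) * (1 + (H(Z) - H(X)) / (X - Z))\<close>; the lemma is its
  coefficient at \<open>X^-(i+1) * Z^-(j+1)\<close>.\<close>

lemma jfrac_step_bilinear:
  assumes "jfrac_step s b t"
  shows "s 0 * s (i + j) = s i * s j + (\<Sum>a<i. \<Sum>c<j. s (i - 1 - a) * t (a + c) * s (j - 1 - c))"
proof (induction i arbitrary: j)
  case 0
  then show ?case by simp
next
  case (Suc i)
  have rec: "s (Suc m) = b * s m + (\<Sum>a<m. s (m - 1 - a) * t a)" for m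
    using assms by (simp add: jfrac_step_def)
  have "s 0 * s (Suc i + j) = s i * s (Suc j) +
      (\<Sum>a<i. \<Sum>c<Suc j. s (i - 1 - a) * t (a + c) * s (j - c))"
    using Suc[of "Suc j"] by simp
  also have "\<dots> = b * s i * s j + s i * (\<Sum>c<j. s (j - 1 - c) * t c) +
      (\<Sum>a<i. s (i - 1 - a) * t a * s j) +
      (\<Sum>a<i. \<Sum>c<j. s (i - 1 - a) * t (Suc (a + c)) * s (j - 1 - c))"
    by (subst rec, subst sum.lessThan_Suc_shift) (simp add: sum.distrib algebra_simps)
  \<comment> \<open>The first and third summands combine to \<open>s (Suc i) * s j\<close>; the
    second is the \<open>a = 0\<close> term of the longer outer sum.\<close>
  also have "\<dots> = s (Suc i) * s j +
      (\<Sum>a<Suc i. \<Sum>c<j. s (i - a) * t (a + c) * s (j - 1 - c))"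
    by (subst rec[of i], subst sum.lessThan_Suc_shift)
      (simp add: sum.distrib sum_distrib_left sum_distrib_right algebra_simps)
  finally show ?case by simp
qed

definition jfrac_block :: "(nat \<Rightarrow> 'a::field) \<Rightarrow> nat \<Rightarrow> nat \<Rightarrow> 'a" where
  "jfrac_block t i j = (if i = 0 then if j = 0 then 1 else 0
     else if j = 0 then 0 else t (i - 1 + (j - 1)))"

lemma jfrac_step_factor:
  assumes "jfrac_step s b t"
  shows "s 0 * s (i + j) =
    (\<Sum>a\<le>i. s (i - a) * (\<Sum>c\<le>j. jfrac_block t a c * s (j - c)))"
  by (subst jfrac_step_bilinear[OF assms])
    (simp add: sum.atMost_shift jfrac_block_def sum_distrib_left algebra_simps)

text \<open>Removes the left Toeplitz factor, which after division by \<open>s 0\<close> is lower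
  triangular with unit diagonal. Only rows are affected, so the column indices
  \<open>\<sigma>\<close> stay free: one choice gives the Hankel determinant, another the shifted
  one.\<close>

lemma det_jfrac_rows:
  assumes "jfrac_step s b t" and "s 0 \<noteq> 0"
  shows "det (mat n n (\<lambda>(i, j). s (i + \<sigma> j))) =
    det (mat n n (\<lambda>(a, j). \<Sum>c\<le>\<sigma> j. jfrac_block t a c * s (\<sigma> j - c)))"
proof -
  let ?N = "\<lambda>a j. \<Sum>c\<le>\<sigma> j. jfrac_block t a c * s (\<sigma> j - c)"
  let ?h = "\<lambda>i a. if a \<le> i then s (i - a) / s 0 else 0"
  have "s (i + \<sigma> j) = (\<Sum>a<n. ?h i a * ?N a j)" if "i < n" for i j
  proof -
    have "(\<Sum>a<n. ?h i a * ?N a j) = (\<Sum>a\<le>i. s (i - a) / s 0 * ?N a j)"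
      using that by (intro sum.mono_neutral_cong_right) auto
    also have "\<dots> = (s 0 * s (i + \<sigma> j)) / s 0"
      unfolding jfrac_step_factor[OF assms(1)] by (simp add: sum_divide_distrib)
    finally show ?thesis using assms(2) by simp
  qed
  then have "mat n n (\<lambda>(i, j). s (i + \<sigma> j)) = mat n n (\<lambda>(i, j). \<Sum>a<n. ?h i a * ?N a j)"
    by (intro eq_matI) auto
  then show ?thesis
    using det_sum_lower[of n ?h ?N] assms(2) by simp
qed

text \<open>The remaining right factor is upper triangular with diagonal \<open>s 0\<close>, which
  accounts for the power.\<close>

lemma hankel_nat_jfrac_step:
  assumes "jfrac_step s b t" and "s 0 \<noteq> 0"
  shows "hankel_nat s (Suc n) = s 0 ^ Suc n * hankel_nat t n"
proof -
  let ?h = "\<lambda>c j. if c \<le> j then s (j - c) else 0"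
  have "(\<Sum>c\<le>j. jfrac_block t a c * s (j - c)) = (\<Sum>c<Suc n. jfrac_block t a c * ?h c j)"
    if "j < Suc n" for a j
    by (intro sum.mono_neutral_cong_left) (use that in \<open>auto split: if_splits\<close>)
  then have "mat (Suc n) (Suc n) (\<lambda>(a, j). \<Sum>c\<le>j. jfrac_block t a c * s (j - c)) =
      mat (Suc n) (Suc n) (\<lambda>(a, j). \<Sum>c<Suc n. jfrac_block t a c * ?h c j)"
    by (intro eq_matI) auto
  then have "hankel_nat s (Suc n) = s 0 ^ Suc n * det (mat (Suc n) (Suc n) (\<lambda>(i, j). jfrac_block t i j))"
    using det_sum_upper[of "Suc n" ?h "jfrac_block t"] det_jfrac_rows[OF assms, of "Suc n" "\<lambda>j. j"]
    by (simp add: hankel_nat_def)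
  then show ?thesis
    by (subst (asm) det_first_column_unit) (simp_all add: jfrac_block_def hankel_nat_def)
qed

lemma shifted_hankel_nat_jfrac_step:
  assumes "jfrac_step s b t" and "s 0 \<noteq> 0"
  shows "shifted_hankel_nat s (Suc n) =
    s 0 ^ Suc n * (shifted_hankel_nat t n + b * hankel_nat t n)"
proof (cases n)
  case 0
  \<comment> \<open>The convention that the shifted determinant of size 0 is 0 leaves exactly this
    equation.\<close>
  have "s 1 = b * s 0"
    using assms(1) by (simp add: jfrac_step_def)
  with 0 show ?thesis
    by (simp add: shifted_hankel_nat_def hankel_nat_def det_single)
next
  case (Suc m)
  let ?B = "jfrac_block t"
  let ?\<sigma> = "\<lambda>j. if j = n then Suc n else j"
  \<comment> \<open>The last column has a term for \<open>c = Suc n\<close>, one beyond the matrix.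
    It is merged with the term for \<open>c = n\<close> into column \<open>n\<close> of
    \<open>?f\<close>, with coefficient 1 in \<open>?h\<close>. The diagonal product is thus only
    \<open>s 0 ^ n\<close>; the missing factor returns when column \<open>n\<close> of
    \<open>?f\<close> is split by linearity.\<close>
  let ?h = "\<lambda>c j. if j = n then if c < n then s (Suc n - c) else 1
    else if c \<le> j then s (j - c) else 0"
  let ?f = "\<lambda>a c. if c = n then s 0 * ?B a (Suc n) + s (Suc 0) * ?B a n else ?B a c"
  have s1: "s (Suc 0) = b * s 0"
    using assms(1) by (simp add: jfrac_step_def)
  have "(\<Sum>c\<le>?\<sigma> j. ?B a c * s (?\<sigma> j - c)) = (\<Sum>c<Suc n. ?f a c * ?h c j)" if "j \<le> n" for a j
  proof (cases "j = n")
    case True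
    have "(\<Sum>c\<le>Suc n. ?B a c * s (Suc n - c)) =
        (\<Sum>c<n. ?B a c * s (Suc n - c)) + ?B a n * s (Suc 0) + ?B a (Suc n) * s 0"
      by (simp flip: lessThan_Suc_atMost)
    then show ?thesis
      using True by (simp add: algebra_simps)
  next
    case False
    have "(\<Sum>c\<le>j. ?B a c * s (j - c)) = (\<Sum>c<Suc n. ?f a c * ?h c j)"
      by (intro sum.mono_neutral_cong_left) (use that False in \<open>auto split: if_splits\<close>)
    then show ?thesis
      using False by simp
  qed
  then have eq: "mat (Suc n) (Suc n) (\<lambda>(a, j). \<Sum>c\<le>?\<sigma> j. ?B a c * s (?\<sigma> j - c)) =
      mat (Suc n) (Suc n) (\<lambda>(a, j). \<Sum>c<Suc n. ?f a c * ?h c j)"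
    by (intro eq_matI) auto
  have "shifted_hankel_nat s (Suc n) = det (mat (Suc n) (Suc n) (\<lambda>(i, j). s (i + ?\<sigma> j)))"
    by (auto simp: shifted_hankel_nat_def intro!: arg_cong[where f = det] eq_matI)
  also have "\<dots> = det (mat (Suc n) (Suc n) (\<lambda>(a, j). ?f a j)) * (\<Prod>j<Suc n. ?h j j)"
    unfolding det_jfrac_rows[OF assms] eq by (rule det_sum_upper) auto
  also have "(\<Prod>j<Suc n. ?h j j) = s 0 ^ n"
    by simp
  also have "det (mat (Suc n) (Suc n) (\<lambda>(a, j). ?f a j)) =
     s 0 * det (mat (Suc n) (Suc n) (\<lambda>(i, j). if j = n then ?B i (Suc n) else ?B i j)) +
     s (Suc 0) * det (mat (Suc n) (Suc n) (\<lambda>(i, j). if j = n then ?B i n else ?B i j))"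
    by (rule det_linear_last_column)
  also have "det (mat (Suc n) (Suc n) (\<lambda>(i, j). if j = n then ?B i (Suc n) else ?B i j)) =
      shifted_hankel_nat t n"
    by (subst det_first_column_unit)
      (use Suc in \<open>auto simp: jfrac_block_def shifted_hankel_nat_def
        intro!: arg_cong[where f = det] eq_matI\<close>)
  also have "det (mat (Suc n) (Suc n) (\<lambda>(i, j). if j = n then ?B i n else ?B i j)) =
      hankel_nat t n"
    by (subst det_first_column_unit)
      (use Suc in \<open>auto simp: jfrac_block_def hankel_nat_def
        intro!: arg_cong[where f = det] eq_matI\<close>)
  finally show ?thesis
    unfolding s1 by (simp add: algebra_simps)
qed

lemma hankel_nat_0 [simp]: "hankel_nat s 0 = 1"
  by (simp add: hankel_nat_def)

lemma shifted_hankel_nat_0 [simp]: "shifted_hankel_nat s 0 = 0"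
  by (simp add: shifted_hankel_nat_def)

section \<open>Infinite J-fractions, with \<open>s n\<close> the coefficients of the
  \<open>n\<close>-th tail\<close>

context
  fixes s :: "nat \<Rightarrow> nat \<Rightarrow> 'a::field" and b :: "nat \<Rightarrow> 'a"
  assumes step: "jfrac_step (s n) (b n) (s (Suc n))"
    and nz: "s n 0 \<noteq> 0"
begin

lemma hankel_nat_jfrac_nonzero: "hankel_nat (s m) n \<noteq> 0"
proof (induction n arbitrary: m)
  case (Suc n)
  then show ?case
    using hankel_nat_jfrac_step[OF step nz, of m n] nz by simp
qed simp

text \<open>A determinant of size \<open>l\<close> contributes \<open>s m 0 ^ l\<close> when passing
  to the next tail. These powers cancel in the quotient because the sizes \<open>n + 2\<close> and
  \<open>n\<close> sum to twice \<open>n + 1\<close>.\<close>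

lemma jfrac_numerator:
  "s (m + Suc n) 0 =
    hankel_nat (s m) (Suc (Suc n)) * hankel_nat (s m) n / hankel_nat (s m) (Suc n) ^ 2"
proof (induction n arbitrary: m)
  case 0
  show ?case
    using nz[of m] by (simp add: hankel_nat_jfrac_step[OF step nz] power2_eq_square)
next
  case (Suc n)
  show ?case
    using Suc[of "Suc m"] nz[of m] hankel_nat_jfrac_nonzero[of "Suc m" "Suc n"]
    by (simp only: hankel_nat_jfrac_step[OF step nz, of m])
      (simp add: field_simps power2_eq_square)
qed

lemma shifted_hankel_nat_quotient:
  "shifted_hankel_nat (s m) (Suc n) / hankel_nat (s m) (Suc n) =
    shifted_hankel_nat (s (Suc m)) n / hankel_nat (s (Suc m)) n + b m"
  using nz[of m] hankel_nat_jfrac_nonzero[of "Suc m" n]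
  by (simp add: hankel_nat_jfrac_step[OF step nz] shifted_hankel_nat_jfrac_step[OF step nz]
      divide_simps)

text \<open>Passing to the next tail removes the same \<open>b m\<close> from both quotients, so
  their difference is preserved until \<open>n = 0\<close>.\<close>

lemma jfrac_shift:
  "b (m + n) = shifted_hankel_nat (s m) (Suc n) / hankel_nat (s m) (Suc n) -
    shifted_hankel_nat (s m) n / hankel_nat (s m) n"
proof (induction n arbitrary: m)
  case 0
  show ?case
    by (simp add: shifted_hankel_nat_quotient)
next
  case (Suc n)
  show ?case
    using Suc[of "Suc m"] by (simp add: shifted_hankel_nat_quotient)
qed

end

section \<open>Expansions at infinity\<close>

lemma poly_at_inf_0 [simp]: "poly_at_inf 0 = 0"
  by (simp add: poly_at_inf_def)

lemma poly_at_inf_pCons: "poly_at_inf (pCons a p) = fls_const a + fls_X_inv * poly_at_inf p"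
  by (simp add: poly_at_inf_def map_poly_pCons)

lemma fls_nth_poly_at_inf:
  "fls_nth (poly_at_inf p) m = (if m > 0 then 0 else coeff p (nat (- m)))"
proof (induction p arbitrary: m)
  case (pCons a p)
  then show ?case
    by (auto simp: poly_at_inf_pCons fls_X_inv_times_conv_shift coeff_pCons nat_diff_distrib
        split: nat.split)
qed simp

lemma poly_at_inf_add: "poly_at_inf (p + q) = poly_at_inf p + poly_at_inf q"
  by (rule fls_eqI) (simp add: fls_nth_poly_at_inf)

lemma poly_at_inf_smult: "poly_at_inf (Polynomial.smult c p) = fls_const c * poly_at_inf p"
  by (rule fls_eqI) (simp add: fls_nth_poly_at_inf)

lemma poly_at_inf_mult: "poly_at_inf (p * q) = poly_at_inf p * poly_at_inf q"
  by (induction p) (simp_all add: poly_at_inf_pCons poly_at_inf_add poly_at_inf_smult algebra_simps)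

lemma fls_nth_monom_times:
  "fls_nth (poly_at_inf (monom a n) * f) m = a * fls_nth f (m + int n)"
proof (induction n arbitrary: m)
  case 0
  then show ?case by (simp add: monom_0 poly_at_inf_pCons)
next
  case (Suc n)
  have "poly_at_inf (monom a (Suc n)) * f = fls_X_inv * (poly_at_inf (monom a n) * f)"
    by (simp add: monom_Suc poly_at_inf_pCons mult.assoc)
  also have "fls_nth \<dots> m = a * fls_nth f (m + int (Suc n))"
    by (simp only: fls_X_inv_times_conv_shift fls_shift_nth Suc) (simp add: algebra_simps)
  finally show ?case .
qed

lemma fls_nth_poly_sum_times:
  "fls_nth (poly_at_inf (\<Sum>j<g. monom (c j) j) * f) m = (\<Sum>j<g. c j * fls_nth f (m + int j))"
  by (induction g) (simp_all add: poly_at_inf_add distrib_right fls_nth_monom_times)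

lemma coeff_sum_monom_lessThan:
  "coeff (\<Sum>j<g. monom (c j) j) i = (if i < g then c i else 0)"
  by (simp add: coeff_sum)

lemma fls_mult_nth_positive:
  fixes f h :: "'a::field fls"
  assumes f: "\<And>m. m \<le> 0 \<Longrightarrow> fls_nth f m = 0" and h: "\<And>m. m \<le> 0 \<Longrightarrow> fls_nth h m = 0"
  shows "fls_nth (f * h) m = (\<Sum>i = 0..m - 2. fls_nth f (i + 1) * fls_nth h (m - 1 - i))"
proof (cases "f = 0 \<or> h = 0")
  case False
  have sub: "1 \<le> fls_subdegree f" "1 \<le> fls_subdegree h"
    by (rule fls_subdegree_geI; use False f h in force)+
  have "fls_nth (f * h) m =
      (\<Sum>i = fls_subdegree f..m - fls_subdegree h. fls_nth f i * fls_nth h (m - i))"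
    by (rule fls_times_nth(2))
  also have "\<dots> = (\<Sum>i = 1..m - 1. fls_nth f i * fls_nth h (m - i))"
    by (rule sum.mono_neutral_left) (use sub in auto)
  also have "\<dots> = (\<Sum>i = 0..m - 2. fls_nth f (i + 1) * fls_nth h (m - 1 - i))"
    by (rule sum.reindex_bij_witness[of _ "\<lambda>i. i + 1" "\<lambda>i. i - 1"]) auto
  finally show ?thesis .
qed auto

lemma jfrac_step_fls:
  fixes H K :: "'a::field fls"
  assumes H: "\<And>m. m \<le> 0 \<Longrightarrow> fls_nth H m = 0" and K: "\<And>m. m \<le> 0 \<Longrightarrow> fls_nth K m = 0"
    and eq: "H * (fls_X_inv - fls_const b - K) = fls_const c"
  shows "jfrac_step (\<lambda>j. fls_nth H (int j + 1)) b (\<lambda>j. fls_nth K (int j + 1))"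
    and "fls_nth H 1 = c"
proof -
  have KH: "fls_nth (K * H) m = (\<Sum>i = 0..m - 2. fls_nth K (i + 1) * fls_nth H (m - 1 - i))" for m
    by (rule fls_mult_nth_positive) (simp_all add: H K)
  \<comment> \<open>Multiplication by \<open>X\<close> shifts coefficients by one. The case
    \<open>m = 0\<close> isolates \<open>c\<close>, and \<open>m = j + 1\<close> is the
    recurrence.\<close>
  have exp: "fls_nth H (m + 1) = b * fls_nth H m + fls_nth (K * H) m + (if m = 0 then c else 0)" for m
  proof -
    have "fls_nth (H * (fls_X_inv - fls_const b - K)) m =
        fls_nth H (m + 1) - b * fls_nth H m - fls_nth (K * H) m"
      by (simp add: right_diff_distrib fls_X_inv_times_conv_shift mult.commute)
    then show ?thesis
      unfolding eq by (auto simp: algebra_simps)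
  qed
  show "fls_nth H 1 = c"
    using exp[of 0] by (simp add: H KH)
  have "fls_nth (K * H) (int j + 1) =
      (\<Sum>i<j. fls_nth H (int (j - 1 - i) + 1) * fls_nth K (int i + 1))" for j
    unfolding KH by (rule sum.reindex_bij_witness[of _ int nat]) (auto simp: of_nat_diff algebra_simps)
  then have "fls_nth H (int (Suc j) + 1) = b * fls_nth H (int j + 1) +
      (\<Sum>i<j. fls_nth H (int (j - 1 - i) + 1) * fls_nth K (int i + 1))" for j
    using exp[of "int j + 1"] by (simp add: algebra_simps)
  then show "jfrac_step (\<lambda>j. fls_nth H (int j + 1)) b (\<lambda>j. fls_nth K (int j + 1))"
    unfolding jfrac_step_def by blast
qed

text \<open>
  The difference \<open>Y - A\<close> has leading coefficient \<open>- 2\<close> at \<open>X ^ (g + 1)\<close>, so \<open>(Y - A) * (Y + A) = 4 * R\<close>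
  bounds the order of \<open>Y + A\<close>.
\<close>

lemma sqrt_expansion_near_neg:
  fixes A R :: "'a::field poly"
  assumes char_not_2: "(2::'a) \<noteq> 0"
    and A: "degree A \<le> g + 1" "coeff A (g + 1) = 1"
    and R: "degree R \<le> g"
    and Y: "sqrt_expansion g (A ^ 2 + 4 * R) (- 1) Y"
    and m: "m \<le> 0"
  shows "fls_nth (Y + poly_at_inf A) m = 0"
proof (cases "Y + poly_at_inf A = 0")
  case False
  let ?Z = "Y - poly_at_inf A" and ?W = "Y + poly_at_inf A"
  have prod: "?Z * ?W = poly_at_inf (4 * R)"
    using Y by (simp add: sqrt_expansion_def poly_at_inf_add poly_at_inf_mult power2_eq_square algebra_simps)
  have "fls_nth ?Z (- int (g + 1)) = - 2"
    using Y A(2) by (simp add: sqrt_expansion_def fls_nth_poly_at_inf nat_add_distrib)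
  with char_not_2 have Z: "fls_subdegree ?Z \<le> - int (g + 1)" "?Z \<noteq> 0"
    by (auto intro: fls_subdegree_leI)
  have "degree (4 * R) \<le> g"
    using degree_mult_le[of 4 R] R by simp
  then have "- int g \<le> fls_subdegree (poly_at_inf (4 * R))"
    using prod False Z by (intro fls_subdegree_geI) (auto simp: fls_nth_poly_at_inf coeff_eq_0)
  then have "1 \<le> fls_subdegree ?W"
    using Z False by (simp flip: prod)
  then show ?thesis
    using m by (intro fls_eq0_below_subdegree) simp
qed simp

section \<open>The J-fraction of the doubly infinite sequence\<close>

lemma hankel_eq_nat: "hankel s n = hankel_nat (\<lambda>j. s (int j)) n"
  by (simp add: hankel_def hankel_nat_def)

lemma shifted_hankel_eq_nat: "shifted_hankel s n = shifted_hankel_nat (\<lambda>j. s (int j)) n"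
  by (simp add: shifted_hankel_def shifted_hankel_nat_def cong: if_cong)

context
  fixes g :: nat and k :: "nat \<Rightarrow> 'a::field" and A R F :: "'a poly"
    and P Q :: "int \<Rightarrow> 'a poly" and u d v :: "int \<Rightarrow> 'a" and \<pi> \<rho> :: "int \<Rightarrow> nat \<Rightarrow> 'a"
    and Y1 Y :: "'a fls"
  assumes char_not_2: "(2::'a) \<noteq> 0"
    and A: "A = monom 1 (g + 1) + (\<Sum>j<g. monom (k j) j)"
    and R: "degree R \<le> g"
    and F: "F = A ^ 2 + 4 * R"
    and Y: "sqrt_expansion g F (- 1) Y"
    and seq: "cf_sequence g A F Y1 P Q u d v \<pi> \<rho>"
begin

lemma P_eq: "P n = A + (\<Sum>j<g. monom (\<pi> n j) j)"
  and Q_eq: "Q n = Polynomial.smult (u n) (monom 1 g + (\<Sum>j<g. monom (\<rho> n j) j))"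
  and u_nonzero: "u n \<noteq> 0"
  and F_eq: "F = P n ^ 2 + Q n * Q (n - 1)"
  and d_u: "4 * d n + u n * u (n - 1) = 0"
  and Q_P: "[:v n, 1:] * Q n = Polynomial.smult (u n / 2) (P (n + 1) + P n)"
  using seq unfolding cf_sequence_def by blast+

lemma coeff_Q: "coeff (Q n) i = u n * (if i = g then 1 else if i < g then \<rho> n i else 0)"
  by (simp add: Q_eq coeff_sum_monom_lessThan)

lemma Q_nonzero: "poly_at_inf (Q n) \<noteq> 0"
proof
  assume "poly_at_inf (Q n) = 0"
  then have "fls_nth (poly_at_inf (Q n)) (- int g) = 0"
    by simp
  then show False
    using u_nonzero[of n] by (simp add: fls_nth_poly_at_inf coeff_Q)
qed

lemma subdegree_Q: "fls_subdegree (poly_at_inf (Q n)) = - int g"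
proof (rule antisym)
  show "fls_subdegree (poly_at_inf (Q n)) \<le> - int g"
    using u_nonzero[of n] by (intro fls_subdegree_leI) (simp add: fls_nth_poly_at_inf coeff_Q)
  show "- int g \<le> fls_subdegree (poly_at_inf (Q n))"
    by (intro fls_subdegree_geI Q_nonzero) (auto simp: fls_nth_poly_at_inf coeff_Q split: if_splits)
qed

lemma Y_square: "Y * Y = poly_at_inf (P n) * poly_at_inf (P n) + poly_at_inf (Q n) * poly_at_inf (Q (n - 1))"
  using Y F_eq[of n] by (simp add: sqrt_expansion_def power2_eq_square poly_at_inf_add poly_at_inf_mult)

lemma Y_plus_P_nth: "fls_nth (Y + poly_at_inf (P n)) m = 0" if "m \<le> - int g"
proof -
  have "coeff A i = (if i = g + 1 then 1 else if i < g then k i else 0)" for i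
    by (simp add: A coeff_sum_monom_lessThan)
  then have "degree A \<le> g + 1" "coeff A (g + 1) = 1"
    by (auto intro!: degree_le)
  then have "fls_nth (Y + poly_at_inf A) m = 0"
    using that Y F by (intro sqrt_expansion_near_neg[OF char_not_2 _ _ R]) auto
  moreover have "fls_nth (poly_at_inf (\<Sum>j<g. monom (\<pi> n j) j)) m = 0"
    using that by (simp add: fls_nth_poly_at_inf coeff_sum_monom_lessThan)
  ultimately show ?thesis
    by (simp add: P_eq poly_at_inf_add)
qed

text \<open>\<open>Y + A\<close> has only negative powers of \<open>X\<close> and
  \<open>P n - A\<close> has degree below \<open>g\<close>, whereas \<open>Q n\<close> has degree
  exactly \<open>g\<close>.\<close>

lemma quotient_nth: "fls_nth ((Y + poly_at_inf (P n)) / poly_at_inf (Q n)) m = 0" if "m \<le> 0"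
proof (cases "Y + poly_at_inf (P n) = 0")
  case False
  let ?H = "(Y + poly_at_inf (P n)) / poly_at_inf (Q n)"
  have H: "?H * poly_at_inf (Q n) = Y + poly_at_inf (P n)" "?H \<noteq> 0"
    using False Q_nonzero[of n] by simp_all
  have "- int g + 1 \<le> fls_subdegree (Y + poly_at_inf (P n))"
    using False by (intro fls_subdegree_geI Y_plus_P_nth) auto
  also have "\<dots> = fls_subdegree ?H - int g"
    using fls_subdegree_mult[OF H(2) Q_nonzero[of n]] unfolding H(1) subdegree_Q by simp
  finally show ?thesis
    using that by (intro fls_eq0_below_subdegree) simp
qed simp

text \<open>
  Up to constants, the tails of the J-fraction of \<open>(Y + P 0) / Q 0\<close> are the quotients at negative
  indices; the factor \<open>u (- n) / 2\<close> makes the partial denominators monic in \<open>X\<close>.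
\<close>

definition cf_tail_factor :: "nat \<Rightarrow> 'a" where
  "cf_tail_factor n = (if n = 0 then 1 else u (- int n) / 2)"

definition cf_tail :: "nat \<Rightarrow> 'a fls" where
  "cf_tail n = fls_const (cf_tail_factor n) *
     ((Y + poly_at_inf (P (- int n))) / poly_at_inf (Q (- int n)))"

lemma cf_tail_nth: "m \<le> 0 \<Longrightarrow> fls_nth (cf_tail n) m = 0"
  by (simp add: cf_tail_def quotient_nth del: times_divide_eq_right)

text \<open>Put \<open>m = - n\<close>. By \<open>Q_P\<close> at \<open>m - 1\<close>, the second
  factor on the left is a constant times \<open>(P m - Y) / Q (m - 1)\<close>. Then
  \<open>(Y + P m) * (P m - Y) = - Q m * Q (m - 1)\<close> cancels both denominators.\<close>

lemma cf_tail_step: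
  "cf_tail n * (fls_X_inv - fls_const (- v (- int (Suc n))) - cf_tail (Suc n)) =
    fls_const (- cf_tail_factor n * u (- int (Suc n)) / 2)"
proof -
  let ?m = "- int n"
  define c where "c = u (?m - 1) / 2"
  define p p' q q' x \<kappa> where defs: "p = poly_at_inf (P ?m)" "p' = poly_at_inf (P (?m - 1))"
    "q = poly_at_inf (Q ?m)" "q' = poly_at_inf (Q (?m - 1))"
    "x = fls_X_inv + fls_const (v (?m - 1))" "\<kappa> = fls_const (cf_tail_factor n)"
  have idx: "- int (Suc n) = ?m - 1" by simp
  have nz: "q \<noteq> 0" "q' \<noteq> 0"
    using Q_nonzero by (simp_all add: defs)
  have "poly_at_inf ([:v (?m - 1), 1:] * Q (?m - 1)) =
      poly_at_inf (Polynomial.smult (u (?m - 1) / 2) (P (?m - 1 + 1) + P (?m - 1)))"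
    by (simp only: Q_P)
  then have x: "x * q' = fls_const c * (p + p')"
    unfolding poly_at_inf_mult poly_at_inf_smult poly_at_inf_add poly_at_inf_pCons
    by (simp add: defs c_def algebra_simps)
  have Ysq: "Y * Y = p * p + q * q'"
    using Y_square[of ?m] by (simp add: defs)
  have "cf_tail n = \<kappa> * ((Y + p) / q)" "cf_tail (Suc n) = fls_const c * ((Y + p') / q')"
    unfolding cf_tail_def cf_tail_factor_def defs c_def idx by simp_all
  then have "cf_tail n * (fls_X_inv - fls_const (- v (?m - 1)) - cf_tail (Suc n)) =
      \<kappa> * ((Y + p) / q) * (x - fls_const c * ((Y + p') / q'))"
    by (simp add: defs)
  also have "x - fls_const c * ((Y + p') / q') = fls_const c * (p - Y) / q'"
    using x nz by (simp add: field_simps)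
  also have "\<kappa> * ((Y + p) / q) * (fls_const c * (p - Y) / q') =
      \<kappa> * fls_const c * ((p * p - Y * Y) / (q * q'))"
    by (simp add: algebra_simps)
  also have "\<dots> = - (\<kappa> * fls_const c)"
    using nz by (simp add: Ysq)
  also have "\<dots> = fls_const (- cf_tail_factor n * u (?m - 1) / 2)"
    by (simp add: defs c_def fls_const_mult_const)
  finally show ?thesis
    unfolding idx .
qed

lemma cf_tail_coeff:
  shows "fls_nth (cf_tail n) 1 = - cf_tail_factor n * u (- int (Suc n)) / 2"
    and "jfrac_step (\<lambda>j. fls_nth (cf_tail n) (int j + 1)) (- v (- int (Suc n)))
      (\<lambda>j. fls_nth (cf_tail (Suc n)) (int j + 1))"
  by (rule jfrac_step_fls; (rule cf_tail_step cf_tail_nth, assumption?))+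

lemma cf_tail_leading_nonzero: "fls_nth (cf_tail n) (int 0 + 1) \<noteq> 0"
  using u_nonzero char_not_2 by (simp add: cf_tail_coeff(1) cf_tail_factor_def)

text \<open>The leading coefficient is \<open>- u m * u (m - 1) / 4\<close> with
  \<open>m = - (n + 1)\<close>, which \<open>d_u\<close> identifies. Tail 0 differs, since its
  factor is 1.\<close>

lemma cf_tail_leading: "fls_nth (cf_tail (Suc n)) 1 = d (- int (Suc n))"
proof -
  define m where "m = - int (Suc n)"
  have m: "- int (Suc (Suc n)) = m - 1"
    by (simp add: m_def)
  \<comment> \<open>Writing 4 as \<open>2 * 2\<close> lets \<open>char_not_2\<close> justify each
    cancellation.\<close>
  have "2 * 2 * d m = - (u m * u (m - 1))"
    using d_u[of m] by (simp add: eq_neg_iff_add_eq_0)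
  then have "u m * u (m - 1) = - (2 * 2 * d m)"
    by simp
  then have "- (u m / 2) * u (m - 1) / 2 = 2 * (2 * d m) / 2 / 2"
    by simp
  then have "- (u m / 2) * u (m - 1) / 2 = d m"
    by (simp only: nonzero_mult_div_cancel_left[OF char_not_2])
  then show ?thesis
    unfolding cf_tail_coeff(1) cf_tail_factor_def m by (simp add: m_def)
qed

lemma cf_tail_0: "cf_tail 0 = (Y + poly_at_inf (P 0)) / poly_at_inf (Q 0)"
  by (simp add: cf_tail_def cf_tail_factor_def)

section \<open>The quadratic equation of \<open>G\<close> and the recurrence for its
  coefficients\<close>

lemma coefficient_recurrence:
  fixes j :: nat and G :: "'a fls" and s :: "int \<Rightarrow> 'a"
  assumes G_def: "G = (Y + poly_at_inf (P 0)) / poly_at_inf (Q 0)"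
    and s_def: "s = (\<lambda>i. if i < 0 then 0 else fls_nth G (i + 1))"
    and j: "j \<ge> 1"
  shows "s (int j) =
         - (\<Sum>i = 2..g + 1. (k (g + 1 - i) + \<pi> 0 (g + 1 - i)) * s (int j - int i))
         + d 0 / s 0 *
           ((\<Sum>i = 0..int j - 2. s i * s (int j - 2 - i))
            + (\<Sum>l = 3..g + 2. \<Sum>i = 0..int j - int l. \<rho> 0 (g + 2 - l) * s i * s (int j - int l - i)))
         + (if j \<le> g then s 0 * \<rho> (- 1) (g - j) else 0)"
proof -
  have G0: "fls_nth G m = 0" if "m \<le> 0" for m
    using quotient_nth[of m 0] that by (simp add: G_def)
  have Gs: "fls_nth G m = s (m - 1)" for m
    by (simp add: s_def G0)
  have GG: "fls_nth (G * G) m = (\<Sum>i = 0..m - 2. s i * s (m - 2 - i))" for m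
  proof -
    have "fls_nth (G * G) m = (\<Sum>i = 0..m - 2. fls_nth G (i + 1) * fls_nth G (m - 1 - i))"
      by (rule fls_mult_nth_positive) (simp_all add: G0)
    also have "m - 1 - i - 1 = m - 2 - i" for i
      by simp
    then have "(\<Sum>i = 0..m - 2. fls_nth G (i + 1) * fls_nth G (m - 1 - i)) =
        (\<Sum>i = 0..m - 2. s i * s (m - 2 - i))"
      by (simp only: Gs add_diff_cancel_right')
    finally show ?thesis .
  qed
  have "poly_at_inf (Q 0) * G = Y + poly_at_inf (P 0)"
    using Q_nonzero[of 0] by (simp add: G_def)
  \<comment> \<open>Expanding this square and using \<open>F = P 0 ^ 2 + Q 0 * Q (- 1)\<close>
    cancels \<open>P 0 ^ 2\<close>, after which \<open>Q 0\<close> divides out.\<close>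
  then have "(poly_at_inf (Q 0) * G - poly_at_inf (P 0)) * (poly_at_inf (Q 0) * G - poly_at_inf (P 0)) = Y * Y"
    by simp
  then have "poly_at_inf (Q 0) * (poly_at_inf (Q 0) * (G * G) - 2 * (poly_at_inf (P 0) * G)) =
      poly_at_inf (Q 0) * poly_at_inf (Q (- 1))"
    unfolding Y_square[of 0] by (simp add: algebra_simps)
  then have "poly_at_inf (Q 0) * (G * G) - 2 * (poly_at_inf (P 0) * G) = poly_at_inf (Q (- 1))"
    by (simp only: mult_left_cancel[OF Q_nonzero])
  then have "poly_at_inf (Q 0) * (G * G) =
      poly_at_inf (P 0) * G + poly_at_inf (P 0) * G + poly_at_inf (Q (- 1))"
    by (simp add: algebra_simps)
  \<comment> \<open>Index \<open>j - g\<close> is the coefficient of \<open>X ^ (g - j)\<close>,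
    chosen so that the leading term \<open>X ^ (g + 1)\<close> of \<open>P 0\<close> contributes
    \<open>s j\<close>.\<close>
  then have eq: "fls_nth (poly_at_inf (Q 0) * (G * G)) (int j - int g) =
      2 * fls_nth (poly_at_inf (P 0) * G) (int j - int g) + fls_nth (poly_at_inf (Q (- 1))) (int j - int g)"
    by (simp only: fls_plus_nth mult_2)
  have "fls_nth (poly_at_inf (Q 0) * (G * G)) (int j - int g) =
      u 0 * (fls_nth (G * G) (int j) + (\<Sum>l<g. \<rho> 0 l * fls_nth (G * G) (int j - int g + int l)))"
    by (simp add: Q_eq poly_at_inf_smult poly_at_inf_add mult.assoc distrib_right
        fls_nth_monom_times fls_nth_poly_sum_times)
  also have "(\<Sum>l<g. \<rho> 0 l * fls_nth (G * G) (int j - int g + int l)) =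
      (\<Sum>l = 3..g + 2. \<rho> 0 (g + 2 - l) * fls_nth (G * G) (int j - int l + 2))"
    by (rule sum.reindex_bij_witness[of _ "\<lambda>l. g + 2 - l" "\<lambda>l. g + 2 - l"])
      (auto simp: of_nat_diff algebra_simps)
  also have "\<dots> =
      (\<Sum>l = 3..g + 2. \<Sum>i = 0..int j - int l. \<rho> 0 (g + 2 - l) * s i * s (int j - int l - i))"
    unfolding GG add_diff_cancel_right' by (simp only: sum_distrib_left mult.assoc)
  finally have QGG: "fls_nth (poly_at_inf (Q 0) * (G * G)) (int j - int g) =
      u 0 * ((\<Sum>i = 0..int j - 2. s i * s (int j - 2 - i))
        + (\<Sum>l = 3..g + 2. \<Sum>i = 0..int j - int l. \<rho> 0 (g + 2 - l) * s i * s (int j - int l - i)))"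
    unfolding GG .
  have "P 0 = monom 1 (g + 1) + (\<Sum>j<g. monom (k j + \<pi> 0 j) j)"
    by (simp add: P_eq A sum.distrib add.assoc flip: add_monom)
  then have "fls_nth (poly_at_inf (P 0) * G) (int j - int g) =
      s (int j) + (\<Sum>l<g. (k l + \<pi> 0 l) * s (int j - int g + int l - 1))"
    by (simp add: poly_at_inf_add distrib_right fls_nth_monom_times fls_nth_poly_sum_times Gs)
  also have "(\<Sum>l<g. (k l + \<pi> 0 l) * s (int j - int g + int l - 1)) =
      (\<Sum>i = 2..g + 1. (k (g + 1 - i) + \<pi> 0 (g + 1 - i)) * s (int j - int i))"
    by (rule sum.reindex_bij_witness[of _ "\<lambda>l. g + 1 - l" "\<lambda>l. g + 1 - l"])
      (auto simp: of_nat_diff algebra_simps)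
  finally have PG: "fls_nth (poly_at_inf (P 0) * G) (int j - int g) =
      s (int j) + (\<Sum>i = 2..g + 1. (k (g + 1 - i) + \<pi> 0 (g + 1 - i)) * s (int j - int i))" .
  \<comment> \<open>Because \<open>j\<close> is at least 1, the leading coefficient of
    \<open>Q (- 1)\<close> does not enter.\<close>
  have Q1: "fls_nth (poly_at_inf (Q (- 1))) (int j - int g) =
      u (- 1) * (if j \<le> g then \<rho> (- 1) (g - j) else 0)"
    using j by (auto simp: fls_nth_poly_at_inf coeff_Q nat_diff_distrib)
  have s0: "s 0 = - u (- 1) / 2"
    using cf_tail_coeff(1)[of 0] by (simp add: s_def cf_tail_0 G_def cf_tail_factor_def)
  have four: "(4::'a) = 2 * 2" by simp
  have "4 * d 0 = - (u 0 * u (- 1))"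
    using d_u[of 0] by (simp add: eq_neg_iff_add_eq_0)
  then have "2 * (d 0 / s 0) = u 0"
    using char_not_2 u_nonzero[of "- 1"] unfolding s0 four by (simp add: field_simps)
  then have D: "u 0 = 2 * (d 0 / s 0)" ..
  have u1: "u (- 1) = - (2 * s 0)"
    using s0 char_not_2 by simp
  \<comment> \<open>With \<open>u 0\<close> and \<open>u (- 1)\<close> expressed through
    \<open>d 0\<close> and \<open>s 0\<close>, every term of \<open>eq\<close> carries a factor 2,
    which is divided out here.\<close>
  have half: "x = - a + D * y + c * r" if "2 * D * y = 2 * (x + a) + - (2 * c) * r" for x a D y c r :: 'a
  proof -
    have "2 * x = 2 * (- a + D * y + c * r)"
      using that by (simp add: algebra_simps)
    then show ?thesis
      by (simp only: mult_left_cancel[OF char_not_2])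
  qed
  have "s (int j) =
         - (\<Sum>i = 2..g + 1. (k (g + 1 - i) + \<pi> 0 (g + 1 - i)) * s (int j - int i))
         + d 0 / s 0 *
           ((\<Sum>i = 0..int j - 2. s i * s (int j - 2 - i))
            + (\<Sum>l = 3..g + 2. \<Sum>i = 0..int j - int l. \<rho> 0 (g + 2 - l) * s i * s (int j - int l - i)))
         + s 0 * (if j \<le> g then \<rho> (- 1) (g - j) else 0)"
    by (rule half[OF eq[unfolded QGG PG Q1 D u1]])
  also have "s 0 * (if j \<le> g then \<rho> (- 1) (g - j) else 0) =
      (if j \<le> g then s 0 * \<rho> (- 1) (g - j) else 0)"
    by simp
  finally show ?thesis .
qed

end

theorem theorem4p4:
  fixes g :: nat
    and k :: "nat \<Rightarrow> 'a::field"
    and A R F :: "'a poly"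
    and P Q :: "int \<Rightarrow> 'a poly"
    and u d v :: "int \<Rightarrow> 'a"
    and \<pi> \<rho> :: "int \<Rightarrow> nat \<Rightarrow> 'a"
    and Y1 Y2 G :: "'a fls"
    and s :: "int \<Rightarrow> 'a"
  assumes char_not_2: "(2::'a) \<noteq> 0"
    and g: "g \<ge> 1"
    and A: "A = monom 1 (g + 1) + (\<Sum>j<g. monom (k j) j)"
    and R: "degree R \<le> g"
    and F: "F = A ^ 2 + 4 * R"
    and Y1: "sqrt_expansion g F 1 Y1"
    and Y2: "sqrt_expansion g F (- 1) Y2"
    and seq: "cf_sequence g A F Y1 P Q u d v \<pi> \<rho>"
    and G: "G = (Y2 + poly_at_inf (P 0)) / poly_at_inf (Q 0)"
    and s: "s = (\<lambda>i. if i < 0 then 0 else fls_nth G (i + 1))"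
  shows "(\<forall>m. fls_nth G m = s (m - 1)) \<and>
    (\<forall>n::nat. n \<ge> 2 \<longrightarrow>
       d (1 - int n) = hankel s n * hankel s (n - 2) / (hankel s (n - 1)) ^ 2) \<and>
    (\<forall>n::nat. n \<ge> 1 \<longrightarrow>
       v (- int n) = shifted_hankel s (n - 1) / hankel s (n - 1) - shifted_hankel s n / hankel s n) \<and>
    s 0 = - u (- 1) / 2 \<and>
    (\<forall>j::nat. j \<ge> 1 \<longrightarrow>
       s (int j) =
         - (\<Sum>i = 2..g + 1. (k (g + 1 - i) + \<pi> 0 (g + 1 - i)) * s (int j - int i))
         + d 0 / s 0 *
           ((\<Sum>i = 0..int j - 2. s i * s (int j - 2 - i))
            + (\<Sum>l = 3..g + 2. \<Sum>i = 0..int j - int l. \<rho> 0 (g + 2 - l) * s i * s (int j - int l - i)))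
         + (if j \<le> g then s 0 * \<rho> (- 1) (g - j) else 0))"
proof -
  note ctx = assms(1,3,4,5,7,8)
  have G_tail: "G = cf_tail P Q u Y2 0"
    unfolding G by (simp add: cf_tail_0[OF ctx])
  let ?s = "\<lambda>n j. fls_nth (cf_tail P Q u Y2 n) (int j + 1)"
  let ?b = "\<lambda>n. - v (- int (Suc n))"
  have s_tail: "(\<lambda>j. s (int j)) = ?s 0"
    by (simp add: s G_tail)
  have step: "jfrac_step (?s n) (?b n) (?s (Suc n))" for n
    by (rule cf_tail_coeff(2)[OF ctx])
  have nz: "?s n 0 \<noteq> 0" for n
    by (rule cf_tail_leading_nonzero[OF ctx])
  have G_nth: "fls_nth G m = s (m - 1)" for m
    using cf_tail_nth[OF ctx, of m 0] by (simp add: s G_tail)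
  have d_eq: "d (1 - int n) = hankel s n * hankel s (n - 2) / (hankel s (n - 1)) ^ 2"
    if "n \<ge> 2" for n
  proof -
    obtain m where n: "n = Suc (Suc m)"
      using \<open>n \<ge> 2\<close> by (metis add_2_eq_Suc le_Suc_ex)
    \<comment> \<open>With \<open>n = m + 2\<close> the index \<open>1 - n\<close> is
      \<open>- (m + 1)\<close>, so this is the leading coefficient of tail
      \<open>m + 1\<close>.\<close>
    have "d (1 - int n) = ?s (0 + Suc m) 0"
      using cf_tail_leading[OF ctx, of m] by (simp add: n)
    also have "\<dots> = hankel_nat (?s 0) (Suc (Suc m)) * hankel_nat (?s 0) m / hankel_nat (?s 0) (Suc m) ^ 2"
      by (rule jfrac_numerator[of ?s ?b, OF step nz])
    finally show ?thesis
      by (simp add: n hankel_eq_nat s_tail)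
  qed
  have v_eq: "v (- int n) =
      shifted_hankel s (n - 1) / hankel s (n - 1) - shifted_hankel s n / hankel s n"
    if "n \<ge> 1" for n
  proof -
    obtain m where n: "n = Suc m"
      using \<open>n \<ge> 1\<close> by (cases n) auto
    \<comment> \<open>The partial denominators \<open>X - b\<close> have \<open>b = - v\<close>,
      which reverses the difference in \<open>jfrac_shift\<close>.\<close>
    have "- ?b (0 + m) = - (shifted_hankel_nat (?s 0) (Suc m) / hankel_nat (?s 0) (Suc m) -
        shifted_hankel_nat (?s 0) m / hankel_nat (?s 0) m)"
      by (rule arg_cong[OF jfrac_shift[of ?s ?b, OF step nz]])
    then show ?thesis
      by (simp add: n hankel_eq_nat shifted_hankel_eq_nat s_tail)
  qed
  have s_0: "s 0 = - u (- 1) / 2"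
    using cf_tail_coeff(1)[OF ctx, of 0] by (simp add: s G_tail cf_tail_factor_def[OF ctx])
  note rec = coefficient_recurrence[OF ctx G s]
  show ?thesis
    by (intro conjI allI impI; (rule G_nth d_eq v_eq s_0 rec; assumption))
qed

end
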